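(* The function counting the number of distinct palindromes in the prefix of length $n$ of a $k$-automatic sequence is not, in general, $k$-synchronized. That is, there exist an integer $k\ge 2$ and a $k$-automatic sequence $\mathbf{x}$ such that the function sending $n$ to the number of distinct palindromic factors of the length-$n$ prefix of $\mathbf{x}$ is not $k$-synchronized.
   Context: A palindrome is a finite word equal to its reversal (the empty word included). A sequence $\mathbf{x}=x_0x_1x_2\cdots$ over a finite alphabet is $k$-automatic if there is a deterministic finite automaton with output that, on reading the base-$k$ representation of $n$, outputs $x_n$. For a pair $(m,n)$ of nonnegative integers, $(m,n)_k$ is the word over the alphabet $\{0,1,\ldots,k-1\}^2$ whose first (resp. second) components spell the base-$k$ representation of $m$ (resp. $n$), most significant digit first, the shorter representation being padded on the left with zeros; e.g. $(6,3)_2=[1,0][1,1][0,1]$. A function $f:\mathbb{N}\to\mathbb{N}$ is $k$-synchronized if there is a finite automaton accepting the language $\{(n,f(n))_k : n\ge 0\}$. *)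

theory Defs
  imports Main "HOL-Library.Sublist"
begin

text \<open>Most significant digit first, without leading zeros; in particular 0 is represented by
  the empty word. Only bases \<open>k \<ge> 2\<close> are meaningful; the test \<open>k < 2\<close> is for termination.\<close>

fun base_rep :: "nat \<Rightarrow> nat \<Rightarrow> nat list" where
  "base_rep k n = (if k < 2 \<or> n = 0 then [] else base_rep k (n div k) @ [n mod k])"

declare base_rep.simps [simp del]

definition pad_left :: "nat \<Rightarrow> nat list \<Rightarrow> nat list" where
  "pad_left l w = replicate (l - length w) 0 @ w"

definition pair_rep :: "nat \<Rightarrow> nat \<Rightarrow> nat \<Rightarrow> (nat \<times> nat) list" where
  "pair_rep k m n =
     (let l = max (length (base_rep k m)) (length (base_rep k n))
      in zip (pad_left l (base_rep k m)) (pad_left l (base_rep k n)))"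

lemma "pair_rep 2 6 3 = [(1, 0), (1, 1), (0, 1)]"
  by (simp add: pair_rep_def pad_left_def base_rep.simps)

definition transition_system ::
    "'a set \<Rightarrow> 's set \<Rightarrow> 's \<Rightarrow> ('s \<Rightarrow> 'a \<Rightarrow> 's) \<Rightarrow> bool" where
  "transition_system \<Sigma> Q q0 \<delta> \<longleftrightarrow>
     finite \<Sigma> \<and> finite Q \<and> q0 \<in> Q \<and> (\<forall>q\<in>Q. \<forall>a\<in>\<Sigma>. \<delta> q a \<in> Q)"

text \<open>Below, states are natural numbers, which is no restriction as state sets are finite.
  The state reached from \<open>q0\<close> after reading \<open>w\<close> is \<open>foldl \<delta> q0 w\<close>.\<close>

definition automatic :: "nat \<Rightarrow> (nat \<Rightarrow> 'a) \<Rightarrow> bool" where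
  "automatic k x \<longleftrightarrow>
     (\<exists>(Q :: nat set) q0 \<delta> \<tau>. transition_system {..<k} Q q0 \<delta> \<and>
        (\<forall>n. x n = \<tau> (foldl \<delta> q0 (base_rep k n))))"

definition recognizable :: "'a set \<Rightarrow> 'a list set \<Rightarrow> bool" where
  "recognizable \<Sigma> L \<longleftrightarrow>
     (\<exists>(Q :: nat set) q0 \<delta> F. transition_system \<Sigma> Q q0 \<delta> \<and> F \<subseteq> Q \<and>
        L = {w \<in> lists \<Sigma>. foldl \<delta> q0 w \<in> F})"

definition synchronized :: "nat \<Rightarrow> (nat \<Rightarrow> nat) \<Rightarrow> bool" where
  "synchronized k f \<longleftrightarrow> recognizable ({..<k} \<times> {..<k}) {pair_rep k n (f n) | n. True}"

definition palindrome :: "'a list \<Rightarrow> bool" where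
  "palindrome w \<longleftrightarrow> rev w = w"

definition seq_prefix :: "(nat \<Rightarrow> 'a) \<Rightarrow> nat \<Rightarrow> 'a list" where
  "seq_prefix x n = map x [0..<n]"

text \<open>\<open>sublist\<close> means contiguous factor; the empty palindrome is counted.\<close>

definition palindrome_count :: "(nat \<Rightarrow> 'a) \<Rightarrow> nat \<Rightarrow> nat" where
  "palindrome_count x n = card {w. palindrome w \<and> sublist w (seq_prefix x n)}"

end

theory Submission imports Defs begin

text \<open>The base-4 word \<open>3 1 0 0 1 2 3 1 0\<^sup>8 1 2 3 1 0\<^sup>4\<^sup>4 1 2 3 1 \<dots>\<close>, with a block \<open>1 2 3 1\<close> at every
  power \<open>4\<^sup>i\<close>, \<open>i \<ge> 1\<close>, has hardly any palindromes: none of length at least 2 contains 2 or 3, so the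
  palindromes other than the letters are powers of 0 and one word \<open>1 0 \<dots> 0 1\<close> for each completed gap.
  Hence the prefix of length \<open>4 ^ (i + 1)\<close> contains exactly \<open>3 \<cdot> 4\<^sup>i + i\<close> palindromes. The logarithmic
  term \<open>i\<close> only affects the last few digits, and pumping the zeros before them contradicts
  synchronization.\<close>

section \<open>Pumping for synchronized functions\<close>

text \<open>Value of a digit string, most significant digit first; \<open>horner_sum\<close> reads
  the least significant digit first, hence \<open>rev\<close>. Leading zeros do not change it, so
  both components of a \<open>pair_rep\<close> can be evaluated whatever their padding.\<close>

definition word_val :: "nat \<Rightarrow> nat list \<Rightarrow> nat" where
  "word_val k w = horner_sum id k (rev w)"

lemma word_val_append: "word_val k (u @ v) = word_val k u * k ^ length v + word_val k v"
  by (simp add: word_val_def horner_sum_append)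

lemma word_val_simps [simp]: "word_val k [] = 0" "word_val k [a] = a"
  by (simp_all add: word_val_def)

lemma word_val_less: "set w \<subseteq> {..<k} \<Longrightarrow> word_val k w < k ^ length w"
proof (induction w rule: rev_induct)
  case (snoc a w)
  then have "Suc (word_val k w) * k \<le> k ^ length w * k"
    by (intro mult_right_mono) auto
  with snoc.prems show ?case by (simp add: word_val_append algebra_simps)
qed simp

lemma word_val_pad_left [simp]: "word_val k (pad_left l w) = word_val k w"
proof -
  have "word_val k (replicate m 0) = 0" for m
    by (induction m) (simp_all add: word_val_def replicate_append_same)
  then show ?thesis by (simp add: pad_left_def word_val_append)
qed

lemma word_val_base_rep: "k \<ge> 2 \<Longrightarrow> word_val k (base_rep k n) = n"
  by (induction k n rule: base_rep.induct)
    (subst base_rep.simps, auto simp: word_val_append)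

lemma set_base_rep: "set (base_rep k n) \<subseteq> {..<k}"
  by (induction k n rule: base_rep.induct) (subst base_rep.simps, auto)

lemma length_pad_left: "length w \<le> l \<Longrightarrow> length (pad_left l w) = l"
  by (simp add: pad_left_def)

lemma set_pad_left: "set (pad_left l w) \<subseteq> insert 0 (set w)"
  by (auto simp: pad_left_def)

lemma word_val_pair_rep:
  assumes "k \<ge> 2"
  shows "word_val k (map fst (pair_rep k m n)) = m" "word_val k (map snd (pair_rep k m n)) = n"
  using assms by (simp_all add: pair_rep_def Let_def length_pad_left word_val_base_rep)

lemma set_map_pair_rep:
  assumes "k \<ge> 2"
  shows "set (map fst (pair_rep k m n)) \<subseteq> {..<k}" "set (map snd (pair_rep k m n)) \<subseteq> {..<k}"
proof -
  have *: "set (pad_left l (base_rep k j)) \<subseteq> {..<k}" for l j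
    using set_pad_left[of l "base_rep k j"] set_base_rep[of k j] assms by auto
  show "set (map fst (pair_rep k m n)) \<subseteq> {..<k}" "set (map snd (pair_rep k m n)) \<subseteq> {..<k}"
    using * by (simp_all add: pair_rep_def Let_def length_pad_left del: set_map)
qed

text \<open>Splitting a word before its last \<open>r\<close> digits is division with remainder by
  \<open>k ^ r\<close>, since those digits have value below \<open>k ^ r\<close>. Using this at
  \<open>s\<close> and at \<open>t\<close> evaluates the word from which the digits of weights
  \<open>k ^ t\<close> up to \<open>k ^ (s - 1)\<close> have been deleted.\<close>

lemma word_val_cut:
  assumes "set w \<subseteq> {..<k}" "k > 0" "t \<le> s" "s \<le> length w"
  shows "word_val k (take (length w - s) w @ drop (length w - t) w) =
    word_val k w div k ^ s * k ^ t + word_val k w mod k ^ t"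
proof -
  have split: "word_val k w div k ^ r = word_val k (take (length w - r) w) \<and>
      word_val k w mod k ^ r = word_val k (drop (length w - r) w)" if "r \<le> length w" for r
  proof -
    have "word_val k w = word_val k (take (length w - r) w) * k ^ r + word_val k (drop (length w - r) w)"
      using word_val_append[of k "take (length w - r) w" "drop (length w - r) w"] that by simp
    moreover have "word_val k (drop (length w - r) w) < k ^ r"
      using word_val_less[of "drop (length w - r) w" k] set_drop_subset[of "length w - r" w] assms that
      by simp
    ultimately show ?thesis using assms(2) by simp
  qed
  show ?thesis using split[of s] split[of t] assms by (simp add: word_val_append)
qed

text \<open>Pumping down: by pigeonhole, two of the states seen with between \<open>t0\<close> and
  \<open>t0 + K\<close> digits unread coincide, and the digits read between them can be deleted. As
  both components are read in parallel, the same cut is applied to \<open>n\<close> and to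
  \<open>f n\<close>. The offset \<open>t0\<close> protects the last digits from the cut.\<close>

lemma synchronized_pumping:
  assumes sync: "synchronized k f" and k: "k \<ge> 2"
  obtains K where "\<And>n t0. k ^ (t0 + K) \<le> n \<Longrightarrow>
    \<exists>t s. t0 \<le> t \<and> t < s \<and> s \<le> t0 + K \<and>
      f (n div k ^ s * k ^ t + n mod k ^ t) = f n div k ^ s * k ^ t + f n mod k ^ t"
proof -
  obtain Q :: "nat set" and q0 \<delta> F where ts: "transition_system ({..<k} \<times> {..<k}) Q q0 \<delta>"
    and L: "{pair_rep k n (f n) | n. True} = {w \<in> lists ({..<k} \<times> {..<k}). foldl \<delta> q0 w \<in> F}"
    using sync unfolding synchronized_def recognizable_def by blast
  have reach: "foldl \<delta> q w \<in> Q" if "q \<in> Q" "w \<in> lists ({..<k} \<times> {..<k})" for q w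
    using that(2,1) by (induction w arbitrary: q) (use ts in \<open>auto simp: transition_system_def\<close>)
  show ?thesis
  proof (rule that[of "card Q"])
    fix n t0 assume n: "k ^ (t0 + card Q) \<le> n"
    define w where "w = pair_rep k n (f n)"
    have w: "w \<in> lists ({..<k} \<times> {..<k})" "foldl \<delta> q0 w \<in> F"
      using L unfolding w_def by blast+
    have "n < k ^ length w"
      using word_val_less[OF set_map_pair_rep(1)[OF k]] word_val_pair_rep(1)[OF k]
      unfolding w_def by (metis length_map)
    with n have "k ^ (t0 + card Q) < k ^ length w" by linarith
    then have len: "t0 + card Q < length w"
      using k by (simp add: power_strict_increasing_iff)
    \<comment> \<open>This is the state when \<open>t\<close> digits are still unread.\<close>
    define st where "st t = foldl \<delta> q0 (take (length w - t) w)" for t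
    have "st ` {t0..t0 + card Q} \<subseteq> Q"
      using ts w(1) by (auto simp: st_def transition_system_def intro!: reach dest: in_set_takeD)
    then have "card (st ` {t0..t0 + card Q}) \<le> card Q"
      using ts by (auto simp: transition_system_def intro: card_mono)
    then have "\<not> inj_on st {t0..t0 + card Q}"
      by (auto dest: card_image)
    then obtain t s where ts': "t0 \<le> t" "t < s" "s \<le> t0 + card Q" "st t = st s"
      by (auto simp: inj_on_def) (metis linorder_neqE_nat)
    define v where "v = take (length w - s) w @ drop (length w - t) w"
    have "foldl \<delta> q0 v = foldl \<delta> (st t) (drop (length w - t) w)"
      using ts' by (simp add: v_def st_def)
    also have "\<dots> = foldl \<delta> q0 w"
      unfolding st_def by (metis append_take_drop_id foldl_append)
    finally have "foldl \<delta> q0 v \<in> F" using w by simp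
    moreover have "v \<in> lists ({..<k} \<times> {..<k})"
      using w(1) by (auto simp: v_def dest!: in_set_takeD in_set_dropD)
    \<comment> \<open>Only words of the form \<open>pair_rep k n' (f n')\<close> are accepted, so
      the shortened word again encodes an argument together with its value.\<close>
    ultimately obtain n' where n': "v = pair_rep k n' (f n')" using L by blast
    have "n' = n div k ^ s * k ^ t + n mod k ^ t"
      using word_val_pair_rep(1)[OF k, of n' "f n'"] word_val_pair_rep(1)[OF k, of n "f n"]
        word_val_cut[OF set_map_pair_rep(1)[OF k, of n "f n"], of t s] k ts' len
      by (simp add: n'[symmetric] w_def[symmetric]) (simp add: v_def take_map drop_map)
    moreover have "f n' = f n div k ^ s * k ^ t + f n mod k ^ t"
      using word_val_pair_rep(2)[OF k, of n' "f n'"] word_val_pair_rep(2)[OF k, of n "f n"]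
        word_val_cut[OF set_map_pair_rep(2)[OF k, of n "f n"], of t s] k ts' len
      by (simp add: n'[symmetric] w_def[symmetric]) (simp add: v_def take_map drop_map)
    ultimately show "\<exists>t s. t0 \<le> t \<and> t < s \<and> s \<le> t0 + card Q \<and>
      f (n div k ^ s * k ^ t + n mod k ^ t) = f n div k ^ s * k ^ t + f n mod k ^ t"
      using ts' by blast
  qed
qed

section \<open>The sequence\<close>

definition pow4 :: "nat \<Rightarrow> bool" where
  "pow4 n \<longleftrightarrow> (\<exists>i. n = 4 ^ i)"

text \<open>For \<open>i \<ge> 1\<close> the numbers with quotient \<open>4 ^ (i - 1)\<close> on
  division by 4 are the four positions of the block starting at \<open>4 ^ i\<close>. The initial
  letters 3 1 act as the tail of a truncated block, so the start obeys the same local rules as the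
  rest.\<close>

definition block_seq :: "nat \<Rightarrow> nat" where
  "block_seq n = (if n = 0 then 3 else if pow4 n then 1
     else if pow4 (n div 4) then [1, 2, 3, 1] ! (n mod 4) else 0)"

text \<open>State 0 means value zero, 1 a power of four, 2 to 4 a power of four followed by the
  digit 1, 2 or 3, and 5 is an absorbing state for all other numbers.\<close>

definition block_step :: "nat \<Rightarrow> nat \<Rightarrow> nat" where
  "block_step q a = (if q = 0 then [0, 1, 5, 5] ! a else if q = 1 then a + 1 else 5)"

lemma pow4_mult: "pow4 (4 * m) \<longleftrightarrow> pow4 m"
proof
  assume "pow4 (4 * m)"
  then obtain i where i: "4 * m = 4 ^ i" by (auto simp: pow4_def)
  then show "pow4 m" by (cases i) (auto simp: pow4_def)
next
  assume "pow4 m"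
  then show "pow4 (4 * m)" by (metis pow4_def power_Suc)
qed

lemma pow4_cases:
  assumes "pow4 n" shows "n = 1 \<or> n mod 4 = 0 \<and> pow4 (n div 4)"
proof -
  obtain i where i: "n = 4 ^ i" using assms by (auto simp: pow4_def)
  then show ?thesis by (cases i) (auto simp: pow4_def)
qed

lemma foldl_block_step:
  "foldl block_step 0 (base_rep 4 n) =
    (if n = 0 then 0 else if pow4 n then 1 else if pow4 (n div 4) then n mod 4 + 1 else 5)"
proof (induction n rule: less_induct)
  case (less n)
  show ?case
  proof (cases "n = 0")
    case True
    then show ?thesis by (simp add: base_rep.simps)
  next
    case False
    define m a where "m = n div 4" and "a = n mod 4"
    have n: "n = 4 * m + a" "a < 4" by (simp_all add: m_def a_def)
    define q where "q = foldl block_step 0 (base_rep 4 m)"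
    have "q = (if m = 0 then 0 else if pow4 m then 1 else if pow4 (m div 4) then m mod 4 + 1 else 5)"
      unfolding q_def by (rule less.IH) (use False in \<open>simp add: m_def\<close>)
    \<comment> \<open>The branch with value \<open>m mod 4 + 1\<close> gives state 1 only for last
      digit 0, and then \<open>m\<close> is itself a power of four; so state 1 characterizes the
      powers.\<close>
    moreover have "pow4 m" if "pow4 (m div 4)" "m mod 4 = 0"
      using that pow4_mult[of "m div 4"] mult_div_mod_eq[of 4 m] by simp
    ultimately have "q = 0 \<longleftrightarrow> m = 0" "m \<noteq> 0 \<Longrightarrow> q = 1 \<longleftrightarrow> pow4 m"
      by (auto split: if_splits)
    moreover have "foldl block_step 0 (base_rep 4 n) = block_step q a"
      using False by (subst base_rep.simps) (simp add: q_def m_def a_def)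
    moreover have "\<not> pow4 0" by (simp add: pow4_def)
    moreover have "pow4 1" unfolding pow4_def by (rule exI[of _ 0]) simp
    moreover have "pow4 n \<longleftrightarrow> n = 1 \<or> a = 0 \<and> pow4 m"
      using pow4_cases[of n, folded m_def a_def] pow4_mult[of m] n(1) \<open>pow4 1\<close> by (metis add_0_right)
    moreover have "a = 0 \<or> a = 1 \<or> a = 2 \<or> a = 3" using n by auto
    ultimately show ?thesis
      using False n(1) unfolding m_def[symmetric] a_def[symmetric] block_step_def[of q a]
      by (cases "m = 0") auto
  qed
qed

lemma automatic_block_seq: "automatic 4 block_seq"
proof -
  have "transition_system {..<4} {..5} 0 block_step"
    by (auto simp: transition_system_def block_step_def less_Suc_eq numeral_eq_Suc)
  moreover have "block_seq n = [3, 1, 2, 3, 1, 0] ! foldl block_step 0 (base_rep 4 n)" for n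
  proof -
    have "n mod 4 = 0 \<or> n mod 4 = 1 \<or> n mod 4 = 2 \<or> n mod 4 = 3" by linarith
    then show ?thesis
      unfolding foldl_block_step block_seq_def by auto
  qed
  ultimately show ?thesis unfolding automatic_def
    by (intro exI[of _ "{..5}"] exI[of _ 0] exI[of _ block_step] exI[of _ "\<lambda>q. [3, 1, 2, 3, 1, 0] ! q"])
      blast
qed

section \<open>Local structure of the sequence between consecutive powers of four\<close>

lemma pow4_bounds:
  assumes "4 ^ i \<le> n" "n < 4 ^ Suc i" shows "pow4 n \<longleftrightarrow> n = 4 ^ i"
proof
  assume "pow4 n"
  then obtain j where j: "n = 4 ^ j" by (auto simp: pow4_def)
  with assms have "i \<le> j" "j < Suc i" by (simp_all del: power_Suc)
  with j show "n = 4 ^ i" by (simp add: less_Suc_eq_le)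
qed (auto simp: pow4_def)

lemma block_seq_small: "block_seq 0 = 3" "block_seq 1 = 1" "block_seq 2 = 0" "block_seq 3 = 0"
  using pow4_bounds[of 0 2] pow4_bounds[of 0 3] pow4_bounds[of 0 1]
  by (auto simp: block_seq_def pow4_def)

text \<open>The range of \<open>r\<close> extends from one power of four to just before the next.
  There the argument and its quotient by 4 each stay between consecutive powers, so each
  \<open>pow4\<close> test succeeds only at the lower bound.\<close>

lemma block_seq_block:
  assumes "i \<ge> 1" "r < 3 * 4 ^ i"
  shows "block_seq (4 ^ i + r) = (if r < 4 then [1, 2, 3, 1] ! r else 0)"
proof -
  obtain j where i: "i = Suc j" using assms by (cases i) auto
  have b: "4 ^ j \<le> (4 ^ i + r) div 4" "(4 ^ i + r) div 4 < 4 ^ Suc j"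
    using assms i by auto
  have d: "(4 ^ i + r) div 4 = 4 ^ j + r div 4" "(4 ^ i + r) mod 4 = r mod 4"
    by (simp_all add: i)
  have p: "pow4 (4 ^ i + r) \<longleftrightarrow> r = 0"
    using pow4_bounds[of i "4 ^ i + r"] assms by auto
  have q: "pow4 ((4 ^ i + r) div 4) \<longleftrightarrow> r < 4"
    using pow4_bounds[OF b] unfolding d by auto
  have "block_seq (4 ^ i + r) = (if r = 0 then 1 else if r < 4 then [1, 2, 3, 1] ! (r mod 4) else 0)"
    unfolding block_seq_def p q d(2) by simp
  then show ?thesis by simp
qed

lemma block_cases:
  fixes n :: nat
  obtains "n = 0" | "n = 1" | "n = 2" | "n = 3"
  | i r where "i \<ge> 1" "n = 4 ^ i + r" "r < 3 * 4 ^ i"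
proof (cases "n < 4")
  case True
  then have "n = 0 \<or> n = 1 \<or> n = 2 \<or> n = 3" by linarith
  then show ?thesis using that(1-4) by blast
next
  case False
  obtain i where i: "4 ^ i \<le> n" "n < 4 ^ (i + 1)"
    using ex_power_ivl1[of 4 n] False by auto
  moreover from i False have "i \<ge> 1" by (cases i) auto
  ultimately show ?thesis using that(5)[of i "n - 4 ^ i"] by auto
qed

lemma block_seq_pow [simp]: "block_seq (4 ^ i) = 1"
  using block_seq_small(2) block_seq_block[of i 0] by (cases "i = 0") auto

text \<open>These local rules are what limits the palindromes: among the six pairs only 00, 01 and
  10 have their reversal in the list, and a 1 after a 0 always opens a block.\<close>

lemma block_seq_Suc:
  "(block_seq n, block_seq (Suc n)) \<in> {(3, 1), (1, 0), (0, 0), (0, 1), (1, 2), (2, 3)}" (is ?pair)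
  "block_seq n = 0 \<Longrightarrow> block_seq (Suc n) = 1 \<Longrightarrow> block_seq (Suc (Suc n)) = 2" (is "?z \<Longrightarrow> ?o \<Longrightarrow> ?t")
proof -
  have small: "block_seq 4 = 1" "block_seq 5 = 2"
    using block_seq_block[of 1 0] block_seq_block[of 1 1] by simp_all
  have "?pair \<and> (?z \<longrightarrow> ?o \<longrightarrow> ?t)"
  proof (cases n rule: block_cases)
    case (5 i r)
    have "(4::nat) ^ i \<ge> 4 ^ 1" using \<open>i \<ge> 1\<close> by (intro power_increasing) auto
    then have big: "(4::nat) ^ i \<ge> 4" by simp
    note val = block_seq_block[OF \<open>i \<ge> 1\<close>]
    show ?thesis
    proof (cases "Suc r < 3 * 4 ^ i")
      case True
      then have next_val: "block_seq (Suc n) = (if Suc r < 4 then [1, 2, 3, 1] ! Suc r else 0)"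
        using val[of "Suc r"] 5 by simp
      have "r = 0 \<or> r = 1 \<or> r = 2 \<or> r = 3 \<or> r \<ge> 4" by linarith
      then show ?thesis unfolding next_val using val[of r] 5 by (elim disjE) simp_all
    next
      case False
      \<comment> \<open>Here \<open>n\<close> is the last zero before the next block.\<close>
      then have "Suc n = 4 ^ Suc i" "r \<ge> 4" using 5 big by auto
      moreover have "block_seq (Suc (4 ^ Suc i)) = 2"
        using block_seq_block[of "Suc i" 1] big by simp
      moreover have "block_seq n = 0" using val[of r] 5 \<open>r \<ge> 4\<close> by simp
      ultimately show ?thesis using block_seq_pow[of "Suc i"] by (simp del: power_Suc)
    qed
  qed (use small block_seq_small in \<open>auto simp: numeral_eq_Suc\<close>)
  then show ?pair "?z \<Longrightarrow> ?o \<Longrightarrow> ?t" by auto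
qed

section \<open>The runs of zeros between blocks\<close>

definition gap_start :: "nat \<Rightarrow> nat" where
  "gap_start j = (if j = 0 then 1 else 4 ^ j + 3)"

text \<open>Run number \<open>j\<close> of zeros lies strictly between the 1 at
  \<open>gap_start j\<close> and the 1 at \<open>4 ^ Suc j\<close>, and this is its length. The case
  \<open>j = 0\<close> is separate because the 1 of the truncated initial block stands at position
  1.\<close>

definition gap :: "nat \<Rightarrow> nat" where
  "gap j = 4 ^ Suc j - Suc (gap_start j)"

lemma pow_ge_4: "j > 0 \<Longrightarrow> (4::nat) ^ j \<ge> 4"
  using power_increasing[of 1 j "4::nat"] by simp

lemma gap_simps: "gap 0 = 2" "j > 0 \<Longrightarrow> gap j = 3 * 4 ^ j - 4"
  by (simp_all add: gap_def gap_start_def)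

lemma gap_end: "gap_start j + gap j + 1 = 4 ^ Suc j"
  using pow_ge_4[of j] by (cases "j = 0") (auto simp: gap_def gap_start_def)

lemma gap_pos: "gap j > 0"
  using gap_simps pow_ge_4[of j] by (cases "j = 0") auto

text \<open>This makes the last run in a prefix the longest one and the gap words pairwise
  distinct.\<close>

lemma strict_mono_gap: "strict_mono gap"
  unfolding strict_mono_Suc_iff
proof
  fix j show "gap j < gap (Suc j)"
    using gap_simps pow_ge_4[of j] by (cases "j = 0") auto
qed

lemma block_seq_gap_start: "block_seq (gap_start j) = 1"
  using block_seq_small(2) block_seq_block[of j 3] pow_ge_4[of j] by (auto simp: gap_start_def)

lemma block_seq_gap:
  assumes "gap_start j < n" "n < 4 ^ Suc j" shows "block_seq n = 0"
proof (cases "j = 0")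
  case True
  with assms have "n = 2 \<or> n = 3" by (auto simp: gap_start_def)
  then show ?thesis using block_seq_small by auto
next
  case False
  then show ?thesis
    using assms block_seq_block[of j "n - 4 ^ j"] by (auto simp: gap_start_def)
qed

lemma block_seq_zeroE:
  assumes "block_seq n = 0" obtains j where "gap_start j < n" "n < 4 ^ Suc j"
proof (cases n rule: block_cases)
  case (5 i r)
  have "r \<ge> 4"
  proof (rule ccontr)
    assume "\<not> r \<ge> 4"
    then have "r = 0 \<or> r = 1 \<or> r = 2 \<or> r = 3" by linarith
    then show False using assms 5 block_seq_block[of i r] by auto
  qed
  then show ?thesis using 5 by (intro that[of i]) (auto simp: gap_start_def)
qed (use assms block_seq_small that[of 0] in \<open>auto simp: gap_start_def\<close>)

lemma block_seq_one_zeroE: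
  assumes "block_seq n = 1" "block_seq (Suc n) = 0" obtains j where "n = gap_start j"
proof -
  obtain j where j: "gap_start j < Suc n" "Suc n < 4 ^ Suc j"
    using assms(2) by (rule block_seq_zeroE)
  with block_seq_gap[of j n] assms(1) have "n = gap_start j" by (cases "gap_start j < n") auto
  then show ?thesis by (rule that)
qed

section \<open>Counting the palindromes\<close>

lemma sublist_seq_prefix:
  "sublist w (seq_prefix x n) \<longleftrightarrow> (\<exists>s l. s + l \<le> n \<and> w = map x [s..<s + l])"
proof
  assume "sublist w (seq_prefix x n)"
  then obtain us vs where uv: "map x [0..<n] = us @ w @ vs"
    by (auto simp: sublist_def seq_prefix_def)
  have len: "length us + length w \<le> n"
    using arg_cong[OF uv, of length] by simp
  have "w = take (length w) (drop (length us) (map x [0..<n]))"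
    by (simp add: uv)
  also have "\<dots> = map x [length us..<length us + length w]"
    using len by (simp add: drop_map take_map)
  finally show "\<exists>s l. s + l \<le> n \<and> w = map x [s..<s + l]" using len by blast
next
  assume "\<exists>s l. s + l \<le> n \<and> w = map x [s..<s + l]"
  then obtain s l where sl: "s + l \<le> n" "w = map x [s..<s + l]" by blast
  obtain d where "n = s + l + d" using sl(1) by (metis le_add_diff_inverse)
  then have "[0..<n] = [0..<s] @ [s..<s + l] @ [s + l..<n]"
    using upt_add_eq_append[of 0 s "l + d"] upt_add_eq_append[of s "s + l" d]
    by (simp add: add.assoc)
  then show "sublist w (seq_prefix x n)"
    unfolding sublist_def seq_prefix_def sl(2) by (metis map_append)
qed

lemma palindrome_window:
  assumes "palindrome (map x [s..<s + l])" "j < l"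
  shows "x (s + j) = x (s + (l - Suc j))"
proof -
  have "rev (map x [s..<s + l]) ! j = map x [s..<s + l] ! j"
    using assms(1) by (simp add: palindrome_def)
  then show ?thesis using assms(2) by (simp add: rev_nth)
qed

text \<open>A palindrome contains the reversal of each of its adjacent pairs, which leaves only 00,
  01 and 10. An interior 1 would follow a 0, hence be followed by 2, which these pairs
  exclude.\<close>

lemma block_seq_palindrome:
  assumes pal: "palindrome (map block_seq [s..<s + l])" and l: "l \<ge> 2"
  shows "\<And>j. 0 < j \<Longrightarrow> Suc j < l \<Longrightarrow> block_seq (s + j) = 0"
    and "block_seq s = block_seq (s + (l - 1))"
    and "block_seq s = 0 \<or> block_seq s = 1 \<and> l \<ge> 3"
proof -
  let ?x = block_seq
  have pair: "(?x (s + j), ?x (s + Suc j)) \<in> {(0, 0), (0, 1), (1, 0)}" if "Suc j < l" for j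
  proof -
    \<comment> \<open>The mirror images of the positions \<open>j\<close> and \<open>Suc j\<close>
      are again adjacent, in the opposite order.\<close>
    have "Suc (s + (l - Suc (Suc j))) = s + (l - Suc j)" using that by simp
    then have "(?x (s + Suc j), ?x (s + j)) \<in> {(3, 1), (1, 0), (0, 0), (0, 1), (1, 2), (2, 3)}"
      using block_seq_Suc(1)[of "s + (l - Suc (Suc j))"] that
        palindrome_window[OF pal, of j] palindrome_window[OF pal, of "Suc j"] by auto
    with block_seq_Suc(1)[of "s + j"] show ?thesis by auto
  qed
  show interior: "?x (s + j) = 0" if "0 < j" "Suc j < l" for j
  proof -
    obtain i where j: "j = Suc i" using \<open>0 < j\<close> by (cases j) auto
    then show ?thesis
      using pair[of i] pair[of j] block_seq_Suc(2)[of "s + i"] that by auto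
  qed
  show ends: "?x s = ?x (s + (l - 1))"
    using palindrome_window[OF pal, of 0] l by simp
  have "\<not> (l = 2 \<and> ?x s = 1)"
    using ends pair[of 0] by auto
  then show "?x s = 0 \<or> ?x s = 1 \<and> l \<ge> 3"
    using pair[of 0] l by auto
qed

lemma map_upt_zeros:
  assumes "\<And>j. j < l \<Longrightarrow> x (s + j) = 0" shows "map x [s..<s + l] = replicate l (0::nat)"
  using assms by (intro nth_equalityI) auto

lemma map_upt_gap:
  assumes "x s = 1" "x (s + Suc m) = 1" "\<And>j. 0 < j \<Longrightarrow> j < Suc m \<Longrightarrow> x (s + j) = 0"
  shows "map x [s..<s + (m + 2)] = 1 # replicate m 0 @ [1::nat]"
proof -
  have "[s..<s + (m + 2)] = s # [Suc s..<Suc s + m] @ [s + Suc m]"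
    using upt_conv_Cons[of s "s + (m + 2)"] by simp
  moreover have "map x [Suc s..<Suc s + m] = replicate m 0"
    using assms(3)[of "Suc j" for j] by (intro map_upt_zeros) auto
  ultimately show ?thesis using assms by simp
qed

definition gap_word :: "nat \<Rightarrow> nat list" where
  "gap_word j = 1 # replicate (gap j) 0 @ [1]"

text \<open>A palindrome of length at least 2 is a zero word inside one run or a whole run with its
  two bounding 1s. The prefix contains all of run \<open>i\<close> but not the 1 closing it, so zero
  words reach length \<open>gap i\<close> while gap words stop below index \<open>i\<close>. The
  bound on \<open>i\<close> ensures that the letter 2, first seen at position 5, occurs.\<close>

lemma palindromes_block_seq:
  assumes i: "i \<ge> 1"
  shows "{w. palindrome w \<and> sublist w (seq_prefix block_seq (4 ^ Suc i))} =
    {[1], [2], [3]} \<union> (\<lambda>m. replicate m 0) ` {..gap i} \<union> gap_word ` {..<i}" (is "?P = ?R")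
proof (intro equalityI subsetI)
  fix w assume "w \<in> ?P"
  then obtain s l where sl: "s + l \<le> 4 ^ Suc i" and w: "w = map block_seq [s..<s + l]"
    and pal: "palindrome (map block_seq [s..<s + l])"
    by (auto simp: sublist_seq_prefix)
  consider "l = 0" | "l = 1" | "l \<ge> 2" by linarith
  then show "w \<in> ?R"
  proof cases
    case 1
    then show ?thesis using w by (auto intro: image_eqI[of _ _ 0])
  next
    case 2
    then have "w = [block_seq s]" using w by simp
    then show ?thesis using block_seq_Suc(1)[of s] gap_pos[of i]
      by (auto intro: image_eqI[of _ _ 1])
  next
    case l: 3
    note interior = block_seq_palindrome(1)[OF pal l] and ends = block_seq_palindrome(2)[OF pal l]
    consider "block_seq s = 0" | "block_seq s = 1" "l \<ge> 3"
      using block_seq_palindrome(3)[OF pal l] by (elim disjE conjE)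
    then show ?thesis
    proof cases
      case 1
      have zero: "block_seq (s + j) = 0" if j: "j < l" for j
      proof -
        consider "j = 0" | "j = l - 1" | "0 < j" "Suc j < l" using j by linarith
        then show ?thesis using 1 ends interior by cases simp_all
      qed
      obtain j where j: "gap_start j < s" "s < 4 ^ Suc j"
        using 1 by (rule block_seq_zeroE)
      \<comment> \<open>A longer window would contain the 1 that closes run
        \<open>j\<close>.\<close>
      have "s + l \<le> 4 ^ Suc j"
      proof (rule ccontr)
        assume "\<not> s + l \<le> 4 ^ Suc j"
        with zero[of "4 ^ Suc j - s"] j have "block_seq (4 ^ Suc j) = 0" by simp
        then show False unfolding block_seq_pow by simp
      qed
      then have "l \<le> gap j" using gap_end[of j] j(1) by linarith
      moreover have "4 ^ j < (4::nat) ^ Suc i"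
        using j sl l by (auto simp: gap_start_def split: if_splits)
      then have "j \<le> i" by (simp del: power_Suc)
      then have "gap j \<le> gap i" by (simp add: strict_mono_less_eq[OF strict_mono_gap])
      moreover have "w = replicate l 0" unfolding w by (intro map_upt_zeros zero)
      ultimately show ?thesis by auto
    next
      case 2
      have "block_seq (Suc s) = 0" using interior[of 1] 2 by simp
      then obtain j where s: "s = gap_start j" using 2(1) block_seq_one_zeroE by blast
      \<comment> \<open>The final 1 must be the one closing run \<open>j\<close>: if it came later,
        the closing 1 would be an interior letter; if earlier, it would lie among the zeros.\<close>
      have "s + (l - 1) \<le> 4 ^ Suc j"
      proof (rule ccontr)
        assume "\<not> s + (l - 1) \<le> 4 ^ Suc j"
        with interior[of "4 ^ Suc j - s"] gap_end[of j] s have "block_seq (4 ^ Suc j) = 0" by simp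
        then show False unfolding block_seq_pow by simp
      qed
      moreover have "4 ^ Suc j \<le> s + (l - 1)"
      proof (rule ccontr)
        assume "\<not> 4 ^ Suc j \<le> s + (l - 1)"
        then have "block_seq (s + (l - 1)) = 0" using 2(2) s by (intro block_seq_gap[of j]) auto
        with 2(1) ends show False by simp
      qed
      ultimately have e: "s + (l - 1) = 4 ^ Suc j" by simp
      then have lj: "l = gap j + 2" using gap_end[of j] s 2 by simp
      have "4 ^ Suc j < (4::nat) ^ Suc i" using e sl 2 by linarith
      then have "j < i" by (simp del: power_Suc)
      moreover have "w = gap_word j"
        unfolding w lj gap_word_def using 2 ends interior lj by (intro map_upt_gap) auto
      ultimately show ?thesis by auto
    qed
  qed
next
  fix w assume "w \<in> ?R"
  then have pal: "palindrome w" by (auto simp: palindrome_def gap_word_def)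
  have big: "(4::nat) ^ Suc i \<ge> 16" using power_increasing[of 2 "Suc i" "4::nat"] i by simp
  have "block_seq 5 = 2" using block_seq_block[of 1 1] by simp
  have "\<exists>s l. s + l \<le> 4 ^ Suc i \<and> w = map block_seq [s..<s + l]"
  proof -
    from \<open>w \<in> ?R\<close> consider "w = [1]" | "w = [2]" | "w = [3]"
      | m where "w = replicate m 0" "m \<le> gap i" | j where "w = gap_word j" "j < i"
      by auto
    then show ?thesis
    proof cases
      case 1
      then show ?thesis using block_seq_small big by (intro exI[of _ 1]) auto
    next
      case 2
      then show ?thesis using \<open>block_seq 5 = 2\<close> big by (intro exI[of _ 5] exI[of _ 1]) auto
    next
      case 3
      then show ?thesis using block_seq_small big by (intro exI[of _ 0] exI[of _ 1]) auto
    next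
      case (4 m)
      have "map block_seq [Suc (gap_start i)..<Suc (gap_start i) + m] = replicate m 0"
        using 4 gap_end[of i] by (intro map_upt_zeros block_seq_gap[of i]) auto
      then show ?thesis using 4 gap_end[of i]
        by (intro exI[of _ "Suc (gap_start i)"] exI[of _ m]) auto
    next
      case (5 j)
      have "map block_seq [gap_start j..<gap_start j + (gap j + 2)] = gap_word j"
        unfolding gap_word_def using gap_end[of j] block_seq_pow[of "Suc j"]
        by (intro map_upt_gap block_seq_gap_start block_seq_gap[of j]) auto
      moreover have "4 ^ Suc j < (4::nat) ^ Suc i" using 5 by (simp del: power_Suc)
      then have "gap_start j + (gap j + 2) \<le> 4 ^ Suc i" using gap_end[of j] by linarith
      ultimately show ?thesis using 5 by metis
    qed
  qed
  with pal show "w \<in> ?P" by (simp add: sublist_seq_prefix)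
qed

text \<open>There are 3 nonzero letters, \<open>gap i + 1\<close> zero words including the empty
  one, and \<open>i\<close> gap words. As \<open>gap i = 3 * 4 ^ i - 4\<close>, the constants
  cancel.\<close>

lemma palindrome_count_block_seq:
  assumes "i \<ge> 1"
  shows "palindrome_count block_seq (4 ^ Suc i) = 3 * 4 ^ i + i"
proof -
  let ?Z = "(\<lambda>m. replicate m (0::nat)) ` {..gap i}" and ?G = "gap_word ` {..<i}"
  have "inj_on gap_word {..<i}"
    by (auto simp: inj_on_def gap_word_def dest!: arg_cong[of _ _ length]
        dest: injD[OF strict_mono_imp_inj_on[OF strict_mono_gap]])
  then have G: "card ?G = i" by (simp add: card_image)
  have "inj_on (\<lambda>m. replicate m (0::nat)) {..gap i}"
    by (auto simp: inj_on_def dest: arg_cong[of _ _ length])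
  then have Z: "card ?Z = gap i + 1" by (simp add: card_image)
  have "set w \<subseteq> {0}" if "w \<in> ?Z" for w using that by auto
  moreover have "1 \<in> set w \<and> length w \<ge> 2" if "w \<in> ?G" for w
    using that by (auto simp: gap_word_def)
  ultimately have "({[1], [2], [3]} \<union> ?Z) \<inter> ?G = {}" "{[1], [2], [3]} \<inter> ?Z = {}"
    by fastforce+
  then have "palindrome_count block_seq (4 ^ Suc i) = 3 + (gap i + 1) + i"
    using palindromes_block_seq[OF assms] G Z
    by (simp add: palindrome_count_def card_Un_disjoint)
  then show ?thesis using gap_simps(2)[of i] pow_ge_4[of i] assms by simp
qed

section \<open>Refuting synchronization by pumping\<close>

theorem theorem5:
  "\<exists>k\<ge>2. \<exists>x :: nat \<Rightarrow> nat. automatic k x \<and> \<not> synchronized k (palindrome_count x)"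
proof -
  let ?f = "palindrome_count block_seq"
  have "\<not> synchronized 4 ?f"
  proof
    assume "synchronized 4 ?f"
    then obtain K where K: "\<And>n t0. 4 ^ (t0 + K) \<le> n \<Longrightarrow>
      \<exists>t s. t0 \<le> t \<and> t < s \<and> s \<le> t0 + K \<and>
        ?f (n div 4 ^ s * 4 ^ t + n mod 4 ^ t) = ?f n div 4 ^ s * 4 ^ t + ?f n mod 4 ^ t"
      by (rule synchronized_pumping) auto
    \<comment> \<open>Pumping \<open>4 ^ Suc i\<close> with \<open>t0 = K\<close> cuts only zeros
      below its leading digit, since \<open>s \<le> 2 * K = i\<close>, and leaves at least
      \<open>K\<close> low digits, enough to hold \<open>i\<close> because
      \<open>2 * K < 4 ^ K\<close>.\<close>
    define i where "i = 2 * K"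
    have "4 ^ (K + K) \<le> (4::nat) ^ Suc i" by (rule power_increasing) (auto simp: i_def)
    from K[OF this] obtain t s where ts: "K \<le> t" "t < s" "s \<le> i" and
      eq: "?f (4 ^ Suc i div 4 ^ s * 4 ^ t + 4 ^ Suc i mod 4 ^ t) =
        ?f (4 ^ Suc i) div 4 ^ s * 4 ^ t + ?f (4 ^ Suc i) mod 4 ^ t"
      unfolding i_def by auto
    \<comment> \<open>This is the number of deleted digits. The bound \<open>p < i\<close> keeps
      \<open>i - p\<close> positive, so the counting formula also applies to the shortened
      argument.\<close>
    define p where "p = s - t"
    have p: "0 < p" "p < i" using ts by (auto simp: p_def i_def)
    have "2 * K < 4 ^ K" by (induction K) auto
    also have "(4::nat) ^ K \<le> 4 ^ t" using ts by (intro power_increasing) auto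
    finally have it: "i < 4 ^ t" by (simp add: i_def)
    moreover have "(4::nat) ^ t \<le> 4 ^ s" using ts by (intro power_increasing) auto
    ultimately have is_less: "i < 4 ^ s" by linarith
    define r where "r = i - s"
    have "s = t + p" "i = s + r" using ts by (auto simp: p_def r_def)
    then have pow: "(4::nat) ^ s = 4 ^ t * 4 ^ p" "(4::nat) ^ i = 4 ^ s * 4 ^ r"
      "(4::nat) ^ (i - p) = 4 ^ t * 4 ^ r"
      by (simp_all add: power_add[symmetric])
    have "4 ^ Suc i div 4 ^ s * 4 ^ t + 4 ^ Suc i mod 4 ^ t = (4::nat) ^ Suc (i - p)"
      by (simp add: pow mult.left_commute[of 4] mult.assoc)
    moreover have "(3 * 4 ^ i + i) div 4 ^ s = 3 * 4 ^ r"
      using is_less by (simp add: pow(2) mult.left_commute[of 3])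
    moreover have "(3 * 4 ^ i + i) mod 4 ^ t = i"
      using it by (simp add: pow(1,2) mult.assoc mult.left_commute[of 3])
    \<comment> \<open>The cut scales the main term correctly but leaves the summand \<open>i\<close>
      in the low digits intact, whereas the true count requires \<open>i - p\<close>.\<close>
    ultimately have "3 * 4 ^ (i - p) + (i - p) = 3 * 4 ^ r * 4 ^ t + i"
      using eq palindrome_count_block_seq[of i] palindrome_count_block_seq[of "i - p"] p
      by (simp del: power_Suc)
    also have "3 * 4 ^ r * 4 ^ t = 3 * (4::nat) ^ (i - p)" by (simp add: pow(3))
    finally show False using p by linarith
  qed
  with automatic_block_seq show ?thesis by (intro exI[of _ 4]) auto
qed

end
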